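(* For each positive integer $k$ and all real numbers $d\in\left(0,\frac1k\right]$ and $\lambda\in[0,1]$ there exists a set $A\subset\mathbb N$ such that $R^k(A)$ is dense in $\mathbb R_+^{k-1}$, $R^{k+1}(A)$ is not dense in $\mathbb R_+^k$, $\underline D(A)=d$ and $\lim_{t\to\infty}\frac{\log A(t)}{\log t}=\lambda$ (in the case $k=1$ the condition "$R^k(A)$ is dense in $\mathbb R_+^{k-1}$" is understood as vacuously satisfied).
   Context: $\mathbb N$ is the set of positive integers, $\mathbb R_+=(0,\infty)$, $\log$ is the natural logarithm, and $A(t)=\#\{a\in A:a\le t\}$. For $m\ge2$ and $A\subset\mathbb N$, $$R^m(A)=\left\{\left(\tfrac{a_1}{b},\dots,\tfrac{a_{m-1}}{b}\right): a_1,\dots,a_{m-1},b\in A\right\}$$ (arbitrary elements of $A$). The dispersion of an infinite set $A=\{a_1<a_2<\cdots\}\subset\mathbb N$ is $$\underline D(A)=\liminf_{n\to\infty}\frac1{a_n}\max\{a_1,\,a_{i+1}-a_i: i\in\{1,\dots,n-1\}\};$$ the condition $\underline D(A)=d$ includes that $A$ is infinite. *)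

theory Defs
  imports "HOL-Analysis.Analysis"
begin

(* Points of R^n are functions on {1..n}, extensional outside {1..n}, because the
   dimension has to be a term (two different dimensions occur in one statement). *)

definition pos_orthant :: "nat \<Rightarrow> (nat \<Rightarrow> real) topology" where
  "pos_orthant n = product_topology (\<lambda>_. top_of_set {0<..}) {1..n}"

definition dense_in_pos_orthant :: "nat \<Rightarrow> (nat \<Rightarrow> real) set \<Rightarrow> bool" where
  "dense_in_pos_orthant n S \<longleftrightarrow> pos_orthant n closure_of S = topspace (pos_orthant n)"

definition ratio_set :: "nat \<Rightarrow> nat set \<Rightarrow> (nat \<Rightarrow> real) set" where
  "ratio_set m A =
     {(\<lambda>i\<in>{1..m - 1}. real (a i) / real b) | a b. (\<forall>i\<in>{1..m - 1}. a i \<in> A) \<and> b \<in> A}"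

definition counting :: "nat set \<Rightarrow> real \<Rightarrow> nat" where
  "counting A t = card {a \<in> A. real a \<le> t}"

(* The increasing enumeration a_1 < a_2 < ... of A is "enumerate A", which starts at
   index 0; the term with index n below is the n+1-st one in the 1-based convention.
   Only meaningful for infinite A. *)
definition dispersion :: "nat set \<Rightarrow> ereal" where
  "dispersion A = liminf (\<lambda>n. ereal (
     real (Max (insert (enumerate A 0) ((\<lambda>i. enumerate A (Suc i) - enumerate A i) ` {..<n})))
       / real (enumerate A n)))"

lemma topspace_pos_orthant: "topspace (pos_orthant n) = ({1..n} \<rightarrow>\<^sub>E {0<..})"
  by (simp add: pos_orthant_def)

lemma ratio_set_subset_pos_orthant:
  assumes "0 \<notin> A"
  shows "ratio_set m A \<subseteq> topspace (pos_orthant (m - 1))"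
proof -
  have "0 < x" if "x \<in> A" for x
    using assms that by (cases x) auto
  then show ?thesis
    by (auto simp: ratio_set_def topspace_pos_orthant PiE_iff)
qed

end

theory Submission
  imports Defs "HOL-Real_Asymp.Real_Asymp"
begin

text \<open>
  The set is a union of clusters, and the \<open>n\<close>-th cluster lives at scale \<open>T n = 2 ^ n\<^sup>2\<close>. It consists
  of \<open>k\<close> blocks; block \<open>j\<close> fills the interval from \<open>q n j * T n\<close> to \<open>width n\<close> times that number
  with an arithmetic progression. Here \<open>width n\<close> tends to the number \<open>c \<ge> 1\<close> determined by
  \<open>c + c^2 + \<dots> + c^k = 1 / d\<close>, which exists because \<open>1 / d \<ge> k\<close>, and the integer tuples
  \<open>(q n 1, \<dots>, q n k)\<close> run through all positive tuples, each infinitely often, with entries at most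
  \<open>n + 1\<close>.

  \<^item> Ratios of \<open>k\<close> elements: the left ends of the blocks of one cluster have the ratios of
    the tuple \<open>q n\<close>, so every positive rational point is a ratio (\<open>dense_ratio_set\<close>).

  \<^item> Ratios of \<open>k + 1\<close> elements: consider \<open>k + 1\<close> elements whose consecutive quotients are larger
    than the width of a block but bounded. As clusters are far apart, they all lie in one cluster,
    so two of them share one of its \<open>k\<close> blocks, which is too narrow for that. Hence a
    whole box of ratios is missed (\<open>not_dense_ratio_set\<close>).

  \<^item> Dispersion: with a largest gap \<open>G\<close>, moving up from the previous cluster, one crosses a gap of
    length at most \<open>G\<close> and then a block, which multiplies the position by at most about \<open>c\<close>; the previous
    clusters are negligible. After \<open>k\<close> blocks the position is at most about
    \<open>(c + \<dots> + c^k) * G = G / d\<close>, whence the lower bound (\<open>dispersion_ge\<close>). Equality is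
    approached along the tuples for which every gap has almost the same length
    (\<open>dispersion_le\<close>).

  \<^item> Counting: consecutive scales satisfy \<open>ln (T (n + 1)) / ln (T n) \<longlonglongrightarrow> 1\<close>, although the scales
    grow apart, and the progressions have about \<open>T n powr l\<close> terms. This determines the exponent
    (\<open>counting_exponent\<close>) and still leaves the steps of the progressions negligible, also for
    \<open>l = 0\<close>.
\<close>

section \<open>Largest gaps\<close>

definition max_gap :: "nat set \<Rightarrow> nat \<Rightarrow> nat" where
  "max_gap A N =
     Max (insert (enumerate A 0) ((\<lambda>i. enumerate A (Suc i) - enumerate A i) ` {..<N}))"

lemma dispersion_eq_liminf_max_gap:
  "dispersion A = liminf (\<lambda>N. ereal (real (max_gap A N) / real (enumerate A N)))"
  by (simp add: dispersion_def max_gap_def)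

text \<open>
  The gap containing a point below the \<open>N\<close>-th element ends at an element of the set; below the least
  element, the gap starts at 0. This turns a bound on the gaps into a search that climbs from any given
  position.
\<close>

lemma element_within_max_gap:
  fixes A :: "nat set" and x :: real
  assumes "infinite A" "0 \<le> x" "x < enumerate A N"
  obtains a where "a \<in> A" "a \<le> enumerate A N" "x < a" "a \<le> x + max_gap A N"
proof -
  define i where "i = (LEAST i. x < enumerate A i)"
  have i: "x < enumerate A i" "i \<le> N"
    unfolding i_def using assms(3) by (auto intro: LeastI Least_le)
  have "real (enumerate A i) \<le> x + max_gap A N"
  proof (cases i)
    case 0
    have "enumerate A 0 \<le> max_gap A N"
      by (simp add: max_gap_def)
    then show ?thesis using 0 assms(2) by simp
  next
    case (Suc j)
    then have "\<not> x < enumerate A j"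
      unfolding i_def by (metis lessI not_less_Least)
    moreover have "enumerate A (Suc j) - enumerate A j \<le> max_gap A N"
      using Suc i(2) by (auto simp: max_gap_def intro!: Max_ge)
    then have "enumerate A (Suc j) \<le> enumerate A j + max_gap A N"
      by linarith
    ultimately show ?thesis unfolding Suc by linarith
  qed
  moreover have "enumerate A i \<le> enumerate A N"
    using i(2) assms(1) by (simp add: enumerate_mono_le_iff)
  ultimately show ?thesis
    using that i(1) enumerate_in_set[OF assms(1)] by blast
qed

text \<open>
  Taking for \<open>u\<close> an element bounds the gap that follows it, and \<open>u = 0\<close> bounds the least element.
\<close>

lemma max_gap_le:
  fixes A :: "nat set"
  assumes "infinite A" "0 \<notin> A"
    and next_elem: "\<And>u. u < enumerate A N \<Longrightarrow> \<exists>v\<in>A. u < v \<and> v \<le> u + g"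
  shows "max_gap A N \<le> g"
proof -
  have "enumerate A N \<noteq> 0"
    using assms enumerate_in_set by metis
  then obtain v where "v \<in> A" "v \<le> g"
    using next_elem[of 0] by auto
  then have "enumerate A 0 \<le> g"
    unfolding enumerate_0 by (meson Least_le le_trans)
  moreover have "enumerate A (Suc i) - enumerate A i \<le> g" if "i < N" for i
  proof -
    have "enumerate A i < enumerate A N"
      using that assms(1) by (simp add: enumerate_mono)
    then obtain v where v: "v \<in> A" "enumerate A i < v" "v \<le> enumerate A i + g"
      using next_elem by blast
    then have "enumerate A (Suc i) \<le> v"
      by (simp add: enumerate_Suc'' assms(1) Least_le)
    then show ?thesis using v by simp
  qed
  ultimately show ?thesis
    by (auto simp: max_gap_def)
qed

section \<open>A recurrent sequence of tuples\<close>

text \<open>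
  The first component of a decoded pair selects a tuple and the second one is free, which produces
  each tuple infinitely often. Cutting the entries off at \<open>n + 1\<close> destroys only finitely many
  occurrences of a given tuple, and keeps each cluster small compared with the distance to the next.
\<close>

lemma exists_recurrent_tuples:
  "\<exists>q :: nat \<Rightarrow> nat \<Rightarrow> nat. (\<forall>n. \<forall>j\<in>{1..k}. 1 \<le> q n j \<and> q n j \<le> n + 1) \<and>
     (\<forall>t. (\<forall>j\<in>{1..k}. 1 \<le> t j) \<longrightarrow> (\<forall>m. \<exists>n\<ge>m. \<forall>j\<in>{1..k}. q n j = t j))"
proof -
  define F :: "(nat \<Rightarrow> nat) set" where "F = ({1..k} \<rightarrow>\<^sub>E {1..})"
  have "countable F"
    unfolding F_def by (intro countable_PiE) auto
  define f where "f n = from_nat_into F (fst (prod_decode n))" for n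
  have "(\<lambda>j\<in>{1..k}. 1) \<in> F"
    by (auto simp: F_def)
  then have fF: "f n \<in> F" for n
    unfolding f_def by (intro from_nat_into) auto
  define q where "q n j = min (n + 1) (f n j)" for n j
  have "\<exists>n\<ge>m. \<forall>j\<in>{1..k}. q n j = t j" if t: "\<forall>j\<in>{1..k}. 1 \<le> t j" for t m
  proof -
    define r where "r = restrict t {1..k}"
    have "r \<in> F"
      using t by (auto simp: r_def F_def)
    then obtain a where a: "from_nat_into F a = r"
      using from_nat_into_surj[OF \<open>countable F\<close>] by blast
    \<comment> \<open>A code is at least as large as its second component, so this \<open>b\<close> lifts \<open>n\<close> above \<open>m\<close>
    and above every entry of \<open>t\<close>.\<close>
  define b where "b = m + (\<Sum>j\<in>{1..k}. t j)"
    define n where "n = prod_encode (a, b)"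
    have "b \<le> n"
      by (simp add: n_def le_prod_encode_2)
    have "q n j = t j" if j: "j \<in> {1..k}" for j
    proof -
      have "t j \<le> (\<Sum>j\<in>{1..k}. t j)"
        using j by (intro member_le_sum) auto
      then have "t j \<le> n + 1"
        using \<open>b \<le> n\<close> by (simp add: b_def)
      then show ?thesis
        using j by (simp add: q_def f_def n_def a r_def)
    qed
    then show ?thesis
      using \<open>b \<le> n\<close> by (intro exI[of _ n]) (auto simp: b_def)
  qed
  moreover have "1 \<le> q n j \<and> q n j \<le> n + 1" if "j \<in> {1..k}" for n j
    using fF[of n] that by (auto simp: q_def F_def PiE_iff)
  ultimately show ?thesis
    by (intro exI[of _ q]) blast
qed

section \<open>The clusters\<close>

text \<open>
  The factor \<open>4 * (c + 2)\<close> is the quotient used in \<open>no_separated_chain\<close>, and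
  \<open>2 * (4 * (c + 2)) ^ k\<close> bounds the spread of the tuples there. Clusters before \<open>start\<close> are discarded
  because they may be too close to each other.
\<close>

locale clusters =
  fixes k start :: nat and c l :: real and q :: "nat \<Rightarrow> nat \<Rightarrow> nat"
  assumes k_ge_1: "1 \<le> k" and c_ge_1: "1 \<le> c" and l_ge_0: "0 \<le> l" and l_le_1: "l \<le> 1"
    and q_ge_1: "j \<in> {1..k} \<Longrightarrow> 1 \<le> q n j"
    and q_le: "j \<in> {1..k} \<Longrightarrow> q n j \<le> n + 1"
    and q_recurrent: "(\<And>j. j \<in> {1..k} \<Longrightarrow> 1 \<le> t j) \<Longrightarrow> \<exists>n\<ge>m. \<forall>j\<in>{1..k}. q n j = t j"
    and separation: "start \<le> n \<Longrightarrow>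
      2 * (4 * (c + 2)) ^ k * (real (n + 1) * (c + 2)) < 2 ^ (2 * n + 1)"
begin

text \<open>
  \<open>T n\<close> is the scale of cluster \<open>n\<close>, and \<open>s n = T n / 2 ^ e n\<close> the step of a progression with
  \<open>q n j = 1\<close>. Since \<open>e n / n\<^sup>2 \<longlonglongrightarrow> l\<close>, a progression has about \<open>T n powr l\<close> terms; the bound \<open>n \<le> e n\<close>
  makes \<open>s n / T n\<close> tend to 0 when \<open>l = 0\<close>. The summand \<open>1 / (n + 1)\<close> in \<open>M n\<close> provides enough
  terms when \<open>c = 1\<close>, without affecting the limit of \<open>width\<close>.
\<close>

definition T :: "nat \<Rightarrow> nat" where "T n = 2 ^ (n\<^sup>2)"

definition e :: "nat \<Rightarrow> nat" where "e n = max n (nat \<lfloor>l * real n ^ 2\<rfloor>)"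

definition s :: "nat \<Rightarrow> nat" where "s n = 2 ^ (n\<^sup>2 - e n)"

definition M :: "nat \<Rightarrow> nat" where "M n = nat \<lceil>(c - 1 + 1 / real (n + 1)) * 2 ^ e n\<rceil>"

definition width :: "nat \<Rightarrow> real" where "width n = 1 + real (M n) / 2 ^ e n"

definition block :: "nat \<Rightarrow> nat \<Rightarrow> nat set" where
  "block n j = (\<lambda>i. q n j * (T n + i * s n)) ` {..M n}"

definition A :: "nat set" where "A = (\<Union>n\<in>{start..}. \<Union>j\<in>{1..k}. block n j)"

subsection \<open>Sizes\<close>

lemma T_pos: "0 < T n" and s_pos: "0 < s n"
  by (simp_all add: T_def s_def)

lemma T_Suc: "T (Suc n) = 2 ^ (2 * n + 1) * T n"
  by (simp add: T_def power2_eq_square flip: power_add)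

lemma T_mono: "m \<le> n \<Longrightarrow> T m \<le> T n"
  by (simp add: T_def)

lemma e_ge: "n \<le> e n"
  by (simp add: e_def)

lemma e_mono: "m \<le> n \<Longrightarrow> e m \<le> e n"
  unfolding e_def using l_ge_0
  by (intro max.mono nat_mono floor_mono mult_left_mono power_mono) auto

lemma e_lower: "l * real n ^ 2 - 1 \<le> e n"
  unfolding e_def by linarith

lemma e_upper: "e n \<le> real n + l * real n ^ 2"
proof -
  have "0 \<le> l * real n ^ 2"
    using l_ge_0 by simp
  then show ?thesis unfolding e_def by linarith
qed

lemma e_le: "e n \<le> n\<^sup>2"
proof -
  have "l * real n ^ 2 \<le> 1 * real n ^ 2"
    using l_le_1 by (intro mult_right_mono) auto
  then have "\<lfloor>l * real n ^ 2\<rfloor> \<le> int (n\<^sup>2)"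
    by (metis floor_mono floor_of_nat mult_1 of_nat_power)
  then have "nat \<lfloor>l * real n ^ 2\<rfloor> \<le> n\<^sup>2"
    by linarith
  then show ?thesis
    by (simp add: e_def power2_nat_le_imp_le)
qed

lemma T_eq: "T n = 2 ^ e n * s n"
  using e_le[of n] by (simp add: T_def s_def flip: power_add)

lemma M_lower: "(c - 1 + 1 / real (n + 1)) * 2 ^ e n \<le> M n"
  unfolding M_def by linarith

lemma M_upper: "M n \<le> (c - 1 + 1 / real (n + 1)) * 2 ^ e n + 1"
proof -
  have "0 \<le> (c - 1 + 1 / real (n + 1)) * 2 ^ e n"
    using c_ge_1 by simp
  then show ?thesis unfolding M_def by linarith
qed

lemma width_lower: "c + 1 / real (n + 1) \<le> width n"
  using M_lower[of n] unfolding width_def by (simp add: field_simps)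

lemma width_upper: "width n \<le> c + 1 / real (n + 1) + 1 / 2 ^ n"
proof -
  have "real (M n) / 2 ^ e n \<le> ((c - 1 + 1 / real (n + 1)) * 2 ^ e n + 1) / 2 ^ e n"
    by (intro divide_right_mono M_upper) simp
  then have "width n \<le> c + 1 / real (n + 1) + 1 / 2 ^ e n"
    unfolding width_def add_divide_distrib by simp
  moreover have "1 / 2 ^ e n \<le> 1 / (2 ^ n :: real)"
    using e_ge[of n] by (simp add: field_simps)
  ultimately show ?thesis by linarith
qed

lemma width_ge: "c \<le> width n"
  using width_lower[of n] by (smt (verit) divide_nonneg_nonneg of_nat_0_le_iff)

lemma width_le: "width n \<le> c + 2"
proof -
  have "1 / real (n + 1) \<le> 1" "1 / (2 ^ n :: real) \<le> 1"
    by (simp_all add: field_simps)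
  then show ?thesis using width_upper[of n] by linarith
qed

lemma width_tendsto: "width \<longlonglongrightarrow> c"
proof (rule tendsto_sandwich)
  show "\<forall>\<^sub>F n in sequentially. c \<le> width n"
    using width_ge by simp
  show "\<forall>\<^sub>F n in sequentially. width n \<le> c + 1 / real (n + 1) + 1 / 2 ^ n"
    using width_upper by simp
  show "(\<lambda>n. c + 1 / real (n + 1) + 1 / 2 ^ n) \<longlonglongrightarrow> c"
    by real_asymp
qed simp

lemma T_add_M_s: "real (T n + M n * s n) = width n * T n"
  by (simp add: T_eq width_def field_simps)

lemma block_bounds:
  assumes "a \<in> block n j"
  shows "real (q n j) * T n \<le> a" "a \<le> real (q n j) * (width n * T n)"
proof -
  obtain i where i: "i \<le> M n" "a = q n j * (T n + i * s n)"
    using assms by (auto simp: block_def)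
  have "q n j * T n \<le> a"
    by (simp add: i)
  then show "real (q n j) * T n \<le> a"
    by (metis of_nat_le_iff of_nat_mult)
  have "a \<le> q n j * (T n + M n * s n)"
    using i by (simp add: mult_le_mono)
  then show "a \<le> real (q n j) * (width n * T n)"
    by (metis T_add_M_s of_nat_le_iff of_nat_mult)
qed

lemma block_cluster_bounds:
  assumes "a \<in> block n j" "j \<in> {1..k}"
  shows "T n \<le> a" "a \<le> real (n + 1) * (c + 2) * T n"
proof -
  have "1 * real (T n) \<le> real (q n j) * T n"
    using q_ge_1[OF assms(2)] by (intro mult_right_mono) auto
  then show "T n \<le> a"
    using block_bounds(1)[OF assms(1)] by linarith
  have "a \<le> real (q n j) * (width n * T n)"
    by (rule block_bounds(2)[OF assms(1)])
  also have "\<dots> \<le> real (n + 1) * ((c + 2) * T n)"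
    using q_le[OF assms(2), of n] width_le[of n] width_ge[of n] c_ge_1
    by (intro mult_mono) auto
  finally show "a \<le> real (n + 1) * (c + 2) * T n" by (simp add: mult_ac)
qed

lemma block_start: "q n j * T n \<in> block n j"
  unfolding block_def by (rule image_eqI[where x = 0]) auto

lemma block_end: "q n j * (T n + M n * s n) \<in> block n j"
  unfolding block_def by auto

lemma A_iff: "a \<in> A \<longleftrightarrow> (\<exists>n\<ge>start. \<exists>j\<in>{1..k}. a \<in> block n j)"
  by (auto simp: A_def)

lemma reach_ge_1: "1 \<le> 2 * (4 * (c + 2)) ^ k"
proof -
  have "1 \<le> (4 * (c + 2)) ^ k"
    using c_ge_1 by (intro one_le_power) auto
  then show ?thesis by linarith
qed

text \<open>
  An element of cluster \<open>m\<close> is at most \<open>(m + 1) * (c + 2) * T m\<close>, which the quadratic exponent of \<open>T\<close>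
  beats by any constant factor.
\<close>

lemma clusters_far_apart:
  assumes "start \<le> m" "m < n" "a \<in> block m i" "i \<in> {1..k}" "b \<in> block n j" "j \<in> {1..k}"
  shows "2 * (4 * (c + 2)) ^ k * a < b"
proof -
  have "2 * (4 * (c + 2)) ^ k * a \<le> 2 * (4 * (c + 2)) ^ k * (real (m + 1) * (c + 2) * T m)"
    using block_cluster_bounds(2)[OF assms(3,4)] c_ge_1
    by (intro mult_left_mono) auto
  also have "\<dots> = 2 * (4 * (c + 2)) ^ k * (real (m + 1) * (c + 2)) * T m"
    by (simp add: mult_ac)
  also have "\<dots> < 2 ^ (2 * m + 1) * real (T m)"
    using separation[OF assms(1)] T_pos by (intro mult_strict_right_mono) auto
  also have "\<dots> = T (Suc m)"
    by (simp add: T_Suc)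
  also have "\<dots> \<le> T n"
    using assms(2) T_mono[of "Suc m" n] by simp
  also have "real (T n) \<le> b"
    using block_cluster_bounds(1)[OF assms(5,6)] by simp
  finally show ?thesis .
qed

lemma A_ge_1: "A \<subseteq> {1..}"
proof
  fix a
  assume "a \<in> A"
  then obtain n j where "j \<in> {1..k}" "a \<in> block n j"
    by (auto simp: A_iff)
  then have "T n \<le> a"
    using block_cluster_bounds(1) by blast
  then show "a \<in> {1..}"
    using T_pos[of n] by simp
qed

lemma T_ge: "n \<le> T n"
  by (metis T_def dual_order.trans le_square less_exp less_imp_le power2_eq_square)

lemma infinite_A: "infinite A"
  unfolding infinite_nat_iff_unbounded_le
proof
  fix m
  define n where "n = max m start"
  have "q n 1 * T n \<in> A"
    unfolding A_iff using block_start[of n 1] k_ge_1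
    by (intro exI[of _ n] conjI bexI[of _ 1]) (simp_all add: n_def)
  moreover have "m \<le> q n 1 * T n"
    using T_ge[of n] q_ge_1[of 1 n] k_ge_1
    by (metis atLeastAtMost_iff le_trans max.cobounded1 mult_le_mono n_def nat_mult_1 order_refl)
  ultimately show "\<exists>n\<ge>m. n \<in> A" by blast
qed

subsection \<open>Density of ratios of k elements\<close>

text \<open>
  A point is approximated by fractions with a common denominator \<open>D\<close>. Their numerators together with \<open>D\<close>
  form a positive tuple \<open>t\<close>, and in a cluster where \<open>q n = t\<close> the left ends of the blocks realise
  these fractions exactly. Rounding down and adding 1 keeps the numerators positive.
\<close>

lemma dense_ratio_set:
  assumes "2 \<le> k"
  shows "dense_in_pos_orthant (k - 1) (ratio_set k A)"
  unfolding dense_in_pos_orthant_def dense_intersects_open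
proof (intro allI impI)
  fix U
  assume "openin (pos_orthant (k - 1)) U \<and> U \<noteq> {}"
  then obtain x where U: "openin (pos_orthant (k - 1)) U" and x: "x \<in> U"
    by blast
  have "\<exists>V. finite {i \<in> {1..k - 1}. V i \<noteq> topspace (top_of_set {0<..})} \<and>
      (\<forall>i\<in>{1..k - 1}. openin (top_of_set {0<..}) (V i)) \<and>
      x \<in> Pi\<^sub>E {1..k - 1} V \<and> Pi\<^sub>E {1..k - 1} V \<subseteq> U"
    using U x unfolding pos_orthant_def openin_product_topology_alt by (rule bspec)
  then obtain V where V: "\<And>i. i \<in> {1..k - 1} \<Longrightarrow> openin (top_of_set {0<..}) (V i)"
    "x \<in> Pi\<^sub>E {1..k - 1} V" "Pi\<^sub>E {1..k - 1} V \<subseteq> U"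
    by blast
  have approx: "\<forall>\<^sub>F D in sequentially. real (nat \<lfloor>x i * real D\<rfloor> + 1) / real D \<in> V i"
    if i: "i \<in> {1..k - 1}" for i
  proof -
    have "open (V i)"
      using V(1)[OF i] open_greaterThan by (rule openin_open_trans)
    have "x i \<in> V i"
      using V(2) i by (rule PiE_mem)
    then have "0 < x i"
      using openin_subset[OF V(1)[OF i]] by auto
    have "(\<lambda>D. real (nat \<lfloor>x i * real D\<rfloor> + 1) / real D) \<longlonglongrightarrow> x i"
    proof (rule tendsto_sandwich)
      show "\<forall>\<^sub>F D in sequentially. x i \<le> real (nat \<lfloor>x i * real D\<rfloor> + 1) / real D"
        using eventually_gt_at_top[of 0]
      proof eventually_elim
        case (elim D)
        have "x i * real D \<le> real (nat \<lfloor>x i * real D\<rfloor> + 1)"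
          by linarith
        then show ?case using elim by (simp add: pos_le_divide_eq)
      qed
      show "\<forall>\<^sub>F D in sequentially. real (nat \<lfloor>x i * real D\<rfloor> + 1) / real D \<le> x i + 1 / real D"
        using eventually_gt_at_top[of 0]
      proof eventually_elim
        case (elim D)
        have "0 \<le> x i * real D"
          using \<open>0 < x i\<close> by simp
        then have "real (nat \<lfloor>x i * real D\<rfloor> + 1) \<le> x i * real D + 1"
          by linarith
        then have "real (nat \<lfloor>x i * real D\<rfloor> + 1) / real D \<le> (x i * real D + 1) / real D"
          by (intro divide_right_mono) auto
        then show ?case using elim by (simp add: add_divide_distrib)
      qed
      show "(\<lambda>D. x i + 1 / real D) \<longlonglongrightarrow> x i"
        by real_asymp
    qed simp
    then show ?thesis
      using \<open>open (V i)\<close> \<open>x i \<in> V i\<close> by (rule topological_tendstoD)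
  qed
  have "\<forall>\<^sub>F D in sequentially. 0 < D \<and>
      (\<forall>i\<in>{1..k - 1}. real (nat \<lfloor>x i * real D\<rfloor> + 1) / real D \<in> V i)"
    using approx by (intro eventually_conj eventually_gt_at_top eventually_ball_finite) auto
  then obtain D where D: "0 < D"
    "\<And>i. i \<in> {1..k - 1} \<Longrightarrow> real (nat \<lfloor>x i * real D\<rfloor> + 1) / real D \<in> V i"
    using eventually_happens'[OF sequentially_bot] by blast
  define t where "t i = (if i < k then nat \<lfloor>x i * real D\<rfloor> + 1 else D)" for i
  have "\<exists>n\<ge>start. \<forall>j\<in>{1..k}. q n j = t j"
    by (rule q_recurrent) (use D(1) in \<open>simp add: t_def\<close>)
  then obtain n where n: "start \<le> n" "\<forall>j\<in>{1..k}. q n j = t j"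
    by blast
  have inA: "t j * T n \<in> A" if "j \<in> {1..k}" for j
    unfolding A_iff using n that block_start[of n j]
    by (intro exI[of _ n] conjI bexI[of _ j]) simp_all
  have t_ratio: "real (t i * T n) / real (t k * T n) = real (nat \<lfloor>x i * real D\<rfloor> + 1) / real D"
    if "i \<in> {1..k - 1}" for i
  proof -
    have "i < k" using that assms by auto
    moreover have "real (a * T n) / real (b * T n) = real a / real b" for a b
      using T_pos[of n] by simp
    ultimately show ?thesis by (simp only: t_def if_True less_irrefl if_False)
  qed
  define y where "y = (\<lambda>i\<in>{1..k - 1}. real (t i * T n) / real (t k * T n))"
  have "\<forall>i\<in>{1..k - 1}. t i * T n \<in> A" "t k * T n \<in> A"
    using k_ge_1 by (auto intro!: inA)
  then have "y \<in> ratio_set k A"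
    unfolding ratio_set_def y_def
    by (intro CollectI exI[of _ "\<lambda>i. t i * T n"] exI[of _ "t k * T n"]) (intro conjI refl; assumption)
  moreover have "y \<in> Pi\<^sub>E {1..k - 1} V"
    using D(2) t_ratio by (auto simp: y_def)
  ultimately show "ratio_set k A \<inter> U \<noteq> {}"
    using V(3) by blast
qed

subsection \<open>Non-density of ratios of k + 1 elements\<close>

text \<open>
  The elements \<open>z i\<close> stay within a factor \<open>2 * (4 * (c + 2)) ^ k\<close> of \<open>z 0\<close>, so they lie in the same
  cluster, and by the pigeonhole principle two of the \<open>k + 1\<close> elements lie in the same block. Their
  quotient is then at most \<open>c + 2\<close>. But it exceeds \<open>(4 * (c + 2)) / 4\<close>, the factors 2 of
  tolerance having been spent on both elements.
\<close>

lemma no_separated_chain: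
  fixes z :: "nat \<Rightarrow> nat"
  assumes z: "\<And>i. i \<le> k \<Longrightarrow> z i \<in> A"
    and z_lower: "\<And>i. i \<le> k \<Longrightarrow> (4 * (c + 2)) ^ i / 2 * z 0 < z i"
    and z_upper: "\<And>i. i \<le> k \<Longrightarrow> z i < 2 * (4 * (c + 2)) ^ i * z 0"
  shows False
proof -
  define K where "K = 4 * (c + 2)"
  have K: "1 \<le> K"
    using c_ge_1 by (simp add: K_def)
  obtain n j0 where n: "start \<le> n" "j0 \<in> {1..k}" "z 0 \<in> block n j0"
    using z[of 0] by (auto simp: A_iff)
  have in_cluster: "\<exists>j. j \<in> {1..k} \<and> z i \<in> block n j" if i: "i \<le> k" for i
  proof -
    obtain m j where m: "start \<le> m" "j \<in> {1..k}" "z i \<in> block m j"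
      using z[OF i] by (auto simp: A_iff)
    have "\<not> m < n"
    proof
      assume "m < n"
      then have "2 * K ^ k * z i < z 0"
        unfolding K_def using m n by (intro clusters_far_apart)
      moreover have "2 * real (z i) \<le> 2 * K ^ k * real (z i)"
        using one_le_power[OF K, of k] by (intro mult_right_mono) auto
      moreover have "1 / 2 * z 0 \<le> K ^ i / 2 * z 0"
        using one_le_power[OF K, of i] by (intro mult_right_mono) auto
      ultimately show False
        using z_lower[OF i] unfolding K_def by linarith
    qed
    moreover have "\<not> n < m"
    proof
      assume "n < m"
      then have "2 * K ^ k * z 0 < z i"
        unfolding K_def using m n by (intro clusters_far_apart)
      moreover have "2 * K ^ i * z 0 \<le> 2 * K ^ k * z 0"
        using power_increasing[OF i K] by (intro mult_right_mono) auto
      ultimately show False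
        using z_upper[OF i] unfolding K_def by linarith
    qed
    ultimately have "m = n" by simp
    then show ?thesis using m by blast
  qed
  \<comment> \<open>\<open>\<sigma> i\<close> is the index of a block that contains \<open>z i\<close>.\<close>
  define \<sigma> where "\<sigma> i = (SOME j. j \<in> {1..k} \<and> z i \<in> block n j)" for i
  have "\<sigma> i \<in> {1..k} \<and> z i \<in> block n (\<sigma> i)" if "i \<le> k" for i
    unfolding \<sigma>_def by (rule someI_ex[OF in_cluster[OF that]])
  then have \<sigma>: "\<And>i. i \<le> k \<Longrightarrow> \<sigma> i \<in> {1..k}" "\<And>i. i \<le> k \<Longrightarrow> z i \<in> block n (\<sigma> i)"
    by simp_all
  have "\<not> inj_on \<sigma> {..k}"
  proof (rule pigeonhole)
    have "card (\<sigma> ` {..k}) \<le> card {1..k}"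
      by (intro card_mono image_subsetI finite_atLeastAtMost) (rule \<sigma>(1), simp)
    then show "card (\<sigma> ` {..k}) < card {..k}"
      by simp
  qed
  then obtain i i' where i: "i < i'" "i' \<le> k" "\<sigma> i = \<sigma> i'"
  proof -
    obtain i i' where "i \<le> k" "i' \<le> k" "\<sigma> i = \<sigma> i'" "i \<noteq> i'"
      using \<open>\<not> inj_on \<sigma> {..k}\<close> unfolding inj_on_def atMost_iff by blast
    then show thesis
      using that[of i i'] that[of i' i] by (cases i i' rule: linorder_cases) simp_all
  qed
  have "z i' \<le> real (q n (\<sigma> i)) * (width n * T n)"
    using \<sigma>(2)[of i'] i by (auto intro: block_bounds)
  also have "\<dots> = width n * (real (q n (\<sigma> i)) * T n)"
    by simp
  also have "\<dots> \<le> (c + 2) * z i"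
    using \<sigma>(2)[of i] i c_ge_1 by (intro mult_mono width_le block_bounds) auto
  also have "\<dots> < (c + 2) * (2 * K ^ i * z 0)"
    unfolding K_def using i z_upper[of i] c_ge_1 by (intro mult_strict_left_mono) auto
  also have "\<dots> = K ^ Suc i / 2 * z 0"
    by (simp add: K_def)
  also have "\<dots> \<le> K ^ i' / 2 * z 0"
    using i K by (intro mult_right_mono divide_right_mono power_increasing) auto
  also have "\<dots> < z i'"
    unfolding K_def using i z_lower by simp
  finally show False .
qed

lemma not_dense_ratio_set: "\<not> dense_in_pos_orthant k (ratio_set (k + 1) A)"
proof
  define K where "K = 4 * (c + 2)"
  have K: "1 \<le> K"
    using c_ge_1 by (simp add: K_def)
  then have K_pos: "0 < K ^ i" for i
    by simp
  define U where "U = Pi\<^sub>E {1..k} (\<lambda>i. {K ^ i / 2 <..< 2 * K ^ i})"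
  have "openin (pos_orthant k) U"
    unfolding U_def pos_orthant_def openin_PiE[OF finite_atLeastAtMost]
  proof (intro disjI2 ballI)
    fix i
    have "0 < x" if "K ^ i / 2 < x" for x
      using that K_pos[of i] by linarith
    then have "{0<..} \<inter> {K ^ i / 2<..<2 * K ^ i} = {K ^ i / 2<..<2 * K ^ i}"
      unfolding set_eq_iff Int_iff greaterThan_iff greaterThanLessThan_iff by blast
    then show "openin (top_of_set {0<..}) {K ^ i / 2<..<2 * K ^ i}"
      by (metis open_greaterThanLessThan openin_open_Int)
  qed
  moreover have "(\<lambda>i\<in>{1..k}. K ^ i) \<in> U"
    using K_pos by (auto simp: U_def)
  moreover assume "dense_in_pos_orthant k (ratio_set (k + 1) A)"
  ultimately obtain y where y: "y \<in> ratio_set (k + 1) A" "y \<in> U"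
    unfolding dense_in_pos_orthant_def dense_intersects_open by blast
  then obtain a b where ab: "\<forall>i\<in>{1..k}. a i \<in> A" "b \<in> A" "y = (\<lambda>i\<in>{1..k}. real (a i) / real b)"
    by (auto simp: ratio_set_def)
  have "0 < real b"
    using ab(2) A_ge_1 by fastforce
  define z where "z i = (if i = 0 then b else a i)" for i
  have bounds: "K ^ i / 2 * z 0 < z i \<and> z i < 2 * K ^ i * z 0" if "i \<le> k" for i
  proof (cases "i = 0")
    case True
    then show ?thesis using \<open>0 < real b\<close> by (simp add: z_def)
  next
    case False
    then have "i \<in> {1..k}" using that by simp
    then have "real (a i) / real b \<in> {K ^ i / 2 <..< 2 * K ^ i}"
      using y(2) ab(3) by (auto simp: U_def PiE_iff)
    then show ?thesis
      using False \<open>0 < real b\<close> by (auto simp: z_def pos_less_divide_eq pos_divide_less_eq)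
  qed
  show False
  proof (rule no_separated_chain[of z])
    show "z i \<in> A" if "i \<le> k" for i
      using ab that by (auto simp: z_def)
  qed (use bounds in \<open>auto simp: K_def\<close>)
qed

subsection \<open>The dispersion from below\<close>

text \<open>
  \<open>r n * T n\<close> bounds everything below cluster \<open>n\<close>, because \<open>T n = 4 ^ n / 2 * T (n - 1)\<close>.
\<close>

definition r :: "nat \<Rightarrow> real" where "r n = real n * (c + 2) * 2 / 4 ^ n"

lemma r_tendsto: "r \<longlonglongrightarrow> 0"
  unfolding r_def by real_asymp

lemma earlier_clusters_small:
  assumes "a \<in> block m i" "i \<in> {1..k}" "m < n"
  shows "a \<le> r n * T n"
proof -
  obtain p where p: "n = Suc p" "m \<le> p"
    using assms(3) by (metis Suc_leI Suc_le_D Suc_le_mono)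
  have "a \<le> real (m + 1) * (c + 2) * T m"
    using assms by (intro block_cluster_bounds)
  also have "\<dots> \<le> real (p + 1) * (c + 2) * T p"
    using p c_ge_1 T_mono[of m p] by (intro mult_mono) auto
  also have "\<dots> = r n * T n"
    by (simp add: p r_def T_Suc power_mult)
  finally show ?thesis .
qed

text \<open>
  The climb starts at \<open>x 0\<close>, above all earlier clusters, and continues with
  \<open>x (i + 1) = width n * (x i + G)\<close>. If \<open>x i\<close> has not reached the given element, then an element within
  \<open>G\<close> above \<open>x i\<close> lies in a block that reaches beyond \<open>x i\<close>, and the whole of that block is
  below \<open>x (i + 1)\<close>. So each step finishes at least one further block, and \<open>k\<close> steps finish the cluster.
  Counting the finished blocks avoids ordering them and allows them to overlap.
\<close>

lemma cluster_le_max_gap: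
  assumes n: "start \<le> n" and j0: "j0 \<in> {1..k}" and y: "enumerate A N \<in> block n j0"
  shows "enumerate A N \<le> width n ^ k * (r n * T n) + (\<Sum>p<k. width n ^ Suc p) * max_gap A N"
proof -
  define y where "y = enumerate A N"
  define G where "G = real (max_gap A N)"
  define w where "w = width n"
  have w: "1 \<le> w"
    using width_ge[of n] c_ge_1 by (simp add: w_def)
  define x where "x i = w ^ i * (r n * T n) + (\<Sum>p<i. w ^ Suc p) * G" for i
  have x_0: "x 0 = r n * T n"
    by (simp add: x_def)
  have "0 \<le> r n"
    using c_ge_1 by (simp add: r_def)
  have x_Suc: "x (Suc i) = w * (x i + G)" for i
    unfolding x_def sum.lessThan_Suc_shift by (simp add: sum_distrib_left algebra_simps)
  have x_nonneg: "0 \<le> x i" for i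
    unfolding x_def G_def using w \<open>0 \<le> r n\<close> by (intro add_nonneg_nonneg mult_nonneg_nonneg sum_nonneg) auto
  have x_mono: "x i \<le> x (Suc i)" for i
  proof -
    have "1 * (x i + G) \<le> w * (x i + G)"
      using w x_nonneg[of i] by (intro mult_right_mono) (auto simp: G_def)
    then show ?thesis by (simp add: x_Suc G_def)
  qed
  have x_0_le: "x 0 \<le> x i" for i
    using x_mono by (simp add: lift_Suc_mono_le)
  \<comment> \<open>The blocks that the climb has left behind completely.\<close>
  define below where "below i = {j \<in> {1..k}. real (q n j) * (w * T n) \<le> x i}" for i
  have greedy: "y \<le> x i \<or> i \<le> card (below i)" for i
  proof (induction i)
    case 0
    show ?case by simp
  next
    case (Suc i)
    show ?case
    proof (cases "y \<le> x i")
      case True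
      then show ?thesis using x_mono[of i] by linarith
    next
      case False
      then obtain a where a: "a \<in> A" "a \<le> y" "x i < a" "a \<le> x i + G"
        using element_within_max_gap[OF infinite_A x_nonneg[of i], of N]
        unfolding y_def G_def not_le by metis
      then obtain m j where m: "start \<le> m" "j \<in> {1..k}" "a \<in> block m j"
        by (auto simp: A_iff)
      have "\<not> m < n"
        using earlier_clusters_small[OF m(3,2), of n] a(3) x_0_le[of i] x_0 by linarith
      moreover have "\<not> n < m"
      proof
        assume "n < m"
        then have "2 * (4 * (c + 2)) ^ k * y < a"
          using n j0 y m unfolding y_def by (intro clusters_far_apart)
        moreover have "1 * real y \<le> 2 * (4 * (c + 2)) ^ k * real y"
          using reach_ge_1 by (intro mult_right_mono) auto
        ultimately show False using a(2) by linarith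
      qed
      ultimately have j: "a \<in> block n j"
        using m(3) by (metis linorder_neqE_nat)
      have "real (q n j) * (w * T n) = w * (real (q n j) * T n)"
        by simp
      also have "\<dots> \<le> w * (x i + G)"
        using block_bounds(1)[OF j] a(4) w by (intro mult_left_mono) auto
      finally have "j \<in> below (Suc i)"
        using m(2) by (simp add: below_def x_Suc)
      moreover have "j \<notin> below i"
        using block_bounds(2)[OF j] a(3) by (auto simp: below_def w_def)
      moreover have "below i \<subseteq> below (Suc i)"
        using x_mono[of i] by (auto simp: below_def)
      ultimately have "card (below i) < card (below (Suc i))"
        by (intro psubset_card_mono) (auto simp: below_def)
      then show ?thesis
        using Suc.IH False by linarith
    qed
  qed
  from greedy[of k] have "y \<le> x k"
  proof
    assume "k \<le> card (below k)"
    have "below k = {1..k}"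
      using \<open>k \<le> card (below k)\<close> by (intro card_seteq) (auto simp: below_def)
    then have "j0 \<in> below k"
      using j0 by (simp only:)
    then have "real (q n j0) * (w * T n) \<le> x k"
      unfolding below_def by blast
    then show ?thesis
      using block_bounds(2)[OF y] by (simp add: y_def w_def)
  qed
  then show ?thesis
    by (simp add: x_def y_def w_def G_def)
qed

text \<open>
  Clusters before \<open>m\<close> are bounded, whereas the \<open>N\<close>-th element is at least \<open>N\<close>.
\<close>

lemma eventually_enumerate_in_late_cluster:
  "\<forall>\<^sub>F N in sequentially. \<exists>n\<ge>m. start \<le> n \<and> (\<exists>j\<in>{1..k}. enumerate A N \<in> block n j)"
proof -
  have "\<forall>\<^sub>F N in sequentially. r m * T m < real N"
    by (metis eventually_gt_at_top filterlim_real_sequentially filterlim_at_top_dense)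
  then show ?thesis
  proof eventually_elim
    case (elim N)
    have "N \<le> enumerate A N"
      using infinite_A by (rule le_enumerate)
    have "enumerate A N \<in> A"
      using infinite_A by (rule enumerate_in_set)
    then obtain n j where n: "start \<le> n" "j \<in> {1..k}" "enumerate A N \<in> block n j"
      by (auto simp: A_iff)
    have "\<not> n < m"
      using earlier_clusters_small[OF n(3,2), of m] elim \<open>N \<le> enumerate A N\<close> by linarith
    then show ?case using n by (intro exI[of _ n]) auto
  qed
qed

text \<open>
  Dividing the estimate of \<open>cluster_le_max_gap\<close> by the element bounds the quotient from below by \<open>B n\<close>,
  where \<open>n\<close> is the cluster of the element.
\<close>

lemma dispersion_ge: "ereal (1 / (\<Sum>p<k. c ^ Suc p)) \<le> dispersion A"
  unfolding dispersion_eq_liminf_max_gap le_Liminf_iff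
proof (intro allI impI)
  fix z
  assume z: "z < ereal (1 / (\<Sum>p<k. c ^ Suc p))"
  have sum_pos: "0 < (\<Sum>p<k. w ^ Suc p)" if "1 \<le> w" for w :: real
    using that k_ge_1 by (intro sum_pos) (auto simp: lessThan_empty_iff)
  define B where "B n = (1 - width n ^ k * r n) / (\<Sum>p<k. width n ^ Suc p)" for n
  have "B \<longlonglongrightarrow> (1 - c ^ k * 0) / (\<Sum>p<k. c ^ Suc p)"
    unfolding B_def using sum_pos[OF c_ge_1]
    by (intro tendsto_intros width_tendsto r_tendsto) simp
  then have "(\<lambda>n. ereal (B n)) \<longlonglongrightarrow> ereal (1 / (\<Sum>p<k. c ^ Suc p))"
    by simp
  then have "\<forall>\<^sub>F n in sequentially. z < ereal (B n)"
    using z by (rule order_tendstoD)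
  then obtain m where m: "\<And>n. m \<le> n \<Longrightarrow> z < ereal (B n)"
    by (auto simp: eventually_sequentially)
  show "\<forall>\<^sub>F N in sequentially. z < ereal (real (max_gap A N) / real (enumerate A N))"
    using eventually_enumerate_in_late_cluster[of m]
  proof eventually_elim
    case (elim N)
    then obtain n j where n: "m \<le> n" "start \<le> n" "j \<in> {1..k}" "enumerate A N \<in> block n j"
      by blast
    define S where "S = (\<Sum>p<k. width n ^ Suc p)"
    have "0 < S"
      unfolding S_def using sum_pos width_ge[of n] c_ge_1 by simp
    define y where "y = real (enumerate A N)"
    have T_le: "T n \<le> y"
      unfolding y_def using block_cluster_bounds(1)[OF n(4,3)] by simp
    then have "0 < y"
      using T_pos[of n] by linarith
    have "0 \<le> width n ^ k * r n"
      using width_ge[of n] c_ge_1 by (simp add: r_def)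
    then have "width n ^ k * r n * T n \<le> width n ^ k * r n * y"
      using T_le by (rule mult_left_mono[rotated])
    then have "(1 - width n ^ k * r n) * y \<le> S * max_gap A N"
      using cluster_le_max_gap[OF n(2-4)] by (simp add: S_def y_def algebra_simps)
    then have "B n \<le> max_gap A N / y"
      unfolding B_def S_def[symmetric] using \<open>0 < S\<close> \<open>0 < y\<close>
      by (simp add: pos_divide_le_eq pos_le_divide_eq mult.commute)
    then have "ereal (B n) \<le> ereal (max_gap A N / y)"
      by simp
    then show ?case
      using m[OF n(1)] unfolding y_def by (rule less_le_trans[rotated])
  qed
qed

end

subsection \<open>The dispersion from above\<close>

text \<open>
  Integer approximations to \<open>N * (1 + c + \<dots> + c^i)\<close>. As left ends of blocks of width \<open>c\<close>, they
  leave gaps of length about \<open>N\<close> everywhere; rounding down guarantees that no gap is longer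
  than \<open>N\<close>, at the price of the \<open>N - 1\<close> in \<open>ladder_lower\<close>.
\<close>

primrec ladder :: "real \<Rightarrow> nat \<Rightarrow> nat \<Rightarrow> nat" where
  "ladder c N 0 = N"
| "ladder c N (Suc i) = nat \<lfloor>c * ladder c N i\<rfloor> + N"

lemma ladder_ge: "N \<le> ladder c N i"
  by (cases i) auto

lemma ladder_Suc_le:
  assumes "0 \<le> c"
  shows "real (ladder c N (Suc i)) \<le> c * real (ladder c N i) + real N"
proof -
  have "0 \<le> c * ladder c N i"
    using assms by simp
  then show ?thesis by simp
qed

lemma ladder_le_Suc:
  assumes "1 \<le> c"
  shows "ladder c N i \<le> ladder c N (Suc i)"
proof -
  have "1 * real (ladder c N i) \<le> c * ladder c N i"
    using assms by (intro mult_right_mono) auto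
  then have "ladder c N i \<le> nat \<lfloor>c * ladder c N i\<rfloor>"
    by (simp add: le_nat_floor)
  then show ?thesis by simp
qed

lemma ladder_lower:
  assumes "1 \<le> c"
  shows "(real N - 1) * (\<Sum>p<Suc i. c ^ p) \<le> ladder c N i"
proof (induction i)
  case (Suc i)
  have "(real N - 1) * (\<Sum>p<Suc (Suc i). c ^ p)
      = c * ((real N - 1) * (\<Sum>p<Suc i. c ^ p)) + (real N - 1)"
    unfolding sum.lessThan_Suc_shift[of _ "Suc i"] by (simp add: sum_distrib_left algebra_simps)
  also have "\<dots> \<le> c * ladder c N i + (real N - 1)"
    using Suc.IH assms by (intro add_right_mono mult_left_mono) auto
  also have "\<dots> \<le> ladder c N (Suc i)"
    unfolding ladder.simps by linarith
  finally show ?case .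
qed simp

context clusters
begin

text \<open>
  Induction over the blocks. Up to the right end of block \<open>i\<close>, the point \<open>u\<close> is before the first block
  or between two blocks, and then the next left end is within \<open>N * T n\<close>; or it is inside a block, where
  the step is at most \<open>N * T n\<close> as soon as \<open>n\<close> is large compared with the tuple.
\<close>

lemma ladder_cluster_next_element:
  assumes N: "1 \<le> N" and n: "start \<le> n" "ladder c N (k - 1) \<le> n"
    and q: "\<And>j. j \<in> {1..k} \<Longrightarrow> q n j = ladder c N (j - 1)"
    and i: "i < k"
    and u: "u < ladder c N i * (T n + M n * s n)"
  shows "\<exists>v\<in>A. u < v \<and> v \<le> u + N * T n"
proof -
  have inA: "ladder c N i * (T n + h * s n) \<in> A" if "i < k" "h \<le> M n" for i h
  proof -
    have "ladder c N i * (T n + h * s n) \<in> block n (Suc i)"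
      unfolding block_def using q[of "Suc i"] that by (intro image_eqI[of _ _ h]) simp_all
    then show ?thesis
      unfolding A_iff using that(1) n(1) by (intro exI[of _ n] conjI bexI[of _ "Suc i"]) simp_all
  qed
  have start_inA: "ladder c N i * T n \<in> A" if "i < k" for i
    using inA[OF that, of 0] by simp
  have step: "ladder c N i * s n \<le> N * T n" if "i < k" for i
  proof -
    have "ladder c N i \<le> ladder c N (k - 1)"
      by (rule lift_Suc_mono_le[where f = "ladder c N"], rule ladder_le_Suc[OF c_ge_1])
        (use that in simp)
    also have "\<dots> \<le> e n"
      using n(2) e_ge[of n] by linarith
    also have "\<dots> \<le> 2 ^ e n"
      by (simp add: less_imp_le)
    also have "\<dots> \<le> N * 2 ^ e n"
      using N by simp
    finally have "ladder c N i * s n \<le> N * 2 ^ e n * s n"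
      by (rule mult_le_mono1)
    then show ?thesis
      by (simp only: T_eq mult.assoc)
  qed
  have inside: "\<exists>v\<in>A. u < v \<and> v \<le> u + N * T n"
    if "i < k" "ladder c N i * T n \<le> u" "u < ladder c N i * (T n + M n * s n)" for i
  proof -
    define L where "L = ladder c N i"
    have L: "L * T n \<le> u" "u < L * T n + M n * (L * s n)"
      using that(2,3) by (simp_all add: L_def algebra_simps)
    have "0 < L"
      using ladder_ge[of N c i] N unfolding L_def by linarith
    then have "0 < L * s n"
      using s_pos by simp
    define h where "h = (u - L * T n) div (L * s n)"
    have "h * (L * s n) + (u - L * T n) mod (L * s n) = u - L * T n"
      unfolding h_def by (rule div_mult_mod_eq)
    moreover have "(u - L * T n) mod (L * s n) < L * s n"
      using \<open>0 < L * s n\<close> by (rule mod_less_divisor)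
    ultimately have h: "L * T n + h * (L * s n) \<le> u" "u < L * T n + h * (L * s n) + L * s n"
      using L(1) by linarith+
    have "h * (L * s n) < M n * (L * s n)"
      using h(1) L(2) by linarith
    then have "h < M n" by simp
    then have "L * (T n + Suc h * s n) \<in> A"
      using inA[OF that(1), of "Suc h"] unfolding L_def by simp
    moreover have "L * (T n + Suc h * s n) = L * T n + h * (L * s n) + L * s n"
      by (simp add: algebra_simps)
    moreover have "L * T n + h * (L * s n) + L * s n \<le> u + N * T n"
      using h(1) step[OF that(1)] unfolding L_def by linarith
    ultimately show ?thesis
      using h(2) by metis
  qed
  show ?thesis
    using i u
  proof (induction i)
    case 0
    show ?case
    proof (cases "u < N * T n")
      case True
      have "N * T n \<in> A"
        using start_inA[OF 0(1)] by simp
      then show ?thesis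
        using True by (intro bexI[of _ "N * T n"]) simp_all
    next
      case False
      then show ?thesis
        using 0 by (intro inside[of 0]) simp_all
    qed
  next
    case (Suc i)
    let ?end = "ladder c N i * (T n + M n * s n)"
    consider "u < ?end" | "?end \<le> u" "u < ladder c N (Suc i) * T n"
      | "ladder c N (Suc i) * T n \<le> u"
      by linarith
    then show ?case
    proof cases
      case 1
      then show ?thesis
        using Suc_lessD[OF Suc.prems(1)] by (intro Suc.IH)
    next
      case 2
      have "real (ladder c N (Suc i) * T n) = real (ladder c N (Suc i)) * T n"
        by simp
      also have "\<dots> \<le> (c * ladder c N i + N) * T n"
        using c_ge_1 by (intro mult_right_mono ladder_Suc_le) simp_all
      also have "\<dots> = c * (real (ladder c N i) * T n) + real N * T n"
        by (simp add: algebra_simps)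
      also have "\<dots> \<le> width n * (real (ladder c N i) * T n) + real N * T n"
        by (intro add_right_mono mult_right_mono width_ge) simp
      also have "\<dots> = real (ladder c N i) * (width n * T n) + real N * T n"
        by simp
      also have "\<dots> = real (?end + N * T n)"
        unfolding T_add_M_s[symmetric] by simp
      finally have "ladder c N (Suc i) * T n \<le> ?end + N * T n"
        by (simp only: of_nat_le_iff)
      then have "ladder c N (Suc i) * T n \<le> u + N * T n"
        using 2(1) by linarith
      then show ?thesis
        using 2(2) start_inA[OF Suc.prems(1)] by blast
    next
      case 3
      then show ?thesis
        using Suc.prems by (intro inside)
    qed
  qed
qed

text \<open>
  The last element of a late cluster whose tuple is a ladder has the required index.
\<close>

lemma frequently_small_max_gap:
  assumes N: "2 \<le> N"
  shows "\<exists>i\<ge>m. max_gap A i / enumerate A i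
    \<le> real N / (real N - 1) / (\<Sum>p<k. c ^ Suc p)"
proof -
  define L where "L = ladder c N (k - 1)"
  \<comment> \<open>The summand \<open>L\<close> makes the steps of the progressions small, and \<open>enumerate A m\<close> puts the cluster
    beyond the \<open>m\<close>-th element.\<close>
  have "\<exists>n\<ge>start + L + enumerate A m. \<forall>j\<in>{1..k}. q n j = ladder c N (j - 1)"
  proof (rule q_recurrent)
    show "1 \<le> ladder c N (j - 1)" for j
      using N ladder_ge[of N c "j - 1"] by linarith
  qed
  then obtain n where n: "start + L + enumerate A m \<le> n"
    and q: "\<And>j. j \<in> {1..k} \<Longrightarrow> q n j = ladder c N (j - 1)"
    by blast
  define y where "y = L * (T n + M n * s n)"
  have "y \<in> A"
    unfolding A_iff using n q[of k] block_end[of n k] k_ge_1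
    by (intro exI[of _ n] conjI bexI[of _ k]) (simp_all add: y_def L_def)
  then obtain i where i: "enumerate A i = y"
    using enumerate_Ex[OF infinite_A] by blast
  have "N \<le> L"
    by (simp add: L_def ladder_ge)
  have "enumerate A m \<le> 1 * T n"
    using n T_ge[of n] by simp
  also have "\<dots> \<le> L * (T n + M n * s n)"
    using \<open>N \<le> L\<close> N by (intro mult_le_mono) simp_all
  also have "\<dots> = enumerate A i"
    by (simp only: i y_def)
  finally have "m \<le> i"
    using infinite_A by (simp add: enumerate_mono_le_iff)
  have "max_gap A i \<le> N * T n"
  proof (rule max_gap_le[OF infinite_A])
    show "0 \<notin> A"
      using A_ge_1 by fastforce
    fix u
    assume "u < enumerate A i"
    then have "u < ladder c N (k - 1) * (T n + M n * s n)"
      by (simp add: i y_def L_def)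
    moreover have "1 \<le> N" "start \<le> n" "ladder c N (k - 1) \<le> n" "k - 1 < k"
      using N n k_ge_1 by (simp_all add: L_def)
    ultimately show "\<exists>v\<in>A. u < v \<and> v \<le> u + N * T n"
      by (intro ladder_cluster_next_element[where i = "k - 1"] q)
  qed
  have "c * (real L * T n) \<le> width n * (real L * T n)"
    by (intro mult_right_mono width_ge) simp
  also have "\<dots> = real L * real (T n + M n * s n)"
    unfolding T_add_M_s by simp
  also have "\<dots> = y"
    by (simp add: y_def)
  finally have y_ge: "c * (real L * T n) \<le> y" .
  define S where "S = (\<Sum>p<k. c ^ Suc p)"
  have "0 < S"
    unfolding S_def using c_ge_1 k_ge_1 by (intro sum_pos) (auto simp: lessThan_empty_iff)
  have "Suc (k - 1) = k"
    using k_ge_1 by simp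
  have "S = c * (\<Sum>p<k. c ^ p)"
    by (simp add: S_def sum_distrib_left)
  then have "(real N - 1) * S = c * ((real N - 1) * (\<Sum>p<k. c ^ p))"
    by simp
  also have "\<dots> \<le> c * L"
    using ladder_lower[OF c_ge_1, of N "k - 1"] c_ge_1 unfolding L_def \<open>Suc (k - 1) = k\<close>
    by (intro mult_left_mono) simp_all
  finally have S_le: "(real N - 1) * S \<le> c * L" .
  have "0 < (real N - 1) * S * T n"
    using N \<open>0 < S\<close> T_pos by simp
  have "max_gap A i / enumerate A i \<le> real (N * T n) / ((real N - 1) * S * T n)"
  proof (rule frac_le)
    show "real (max_gap A i) \<le> real (N * T n)"
      using \<open>max_gap A i \<le> N * T n\<close> by (simp only: of_nat_le_iff)
    have "(real N - 1) * S * T n \<le> c * L * T n"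
      using S_le by (intro mult_right_mono) auto
    then show "(real N - 1) * S * T n \<le> enumerate A i"
      using y_ge by (simp add: i mult.assoc)
  qed (use \<open>0 < (real N - 1) * S * T n\<close> in auto)
  also have "\<dots> = real N / (real N - 1) / S"
    using T_pos[of n] by simp
  finally show ?thesis
    using \<open>m \<le> i\<close> unfolding S_def by blast
qed

lemma dispersion_le: "dispersion A \<le> ereal (1 / (\<Sum>p<k. c ^ Suc p))"
proof (rule tendsto_lowerbound)
  have "(\<lambda>N. real N / (real N - 1) / (\<Sum>p<k. c ^ Suc p)) \<longlonglongrightarrow> 1 / (\<Sum>p<k. c ^ Suc p)"
  proof (rule tendsto_divide)
    show "(\<lambda>N. real N / (real N - 1)) \<longlonglongrightarrow> 1"
      by real_asymp
    have "0 < (\<Sum>p<k. c ^ Suc p)"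
      using c_ge_1 k_ge_1 by (intro sum_pos) (auto simp: lessThan_empty_iff)
    then show "(\<Sum>p<k. c ^ Suc p) \<noteq> 0" by simp
  qed simp
  then show "(\<lambda>N. ereal (real N / (real N - 1) / (\<Sum>p<k. c ^ Suc p))) \<longlonglongrightarrow>
      ereal (1 / (\<Sum>p<k. c ^ Suc p))"
    by simp
  show "\<forall>\<^sub>F N in sequentially.
      dispersion A \<le> ereal (real N / (real N - 1) / (\<Sum>p<k. c ^ Suc p))"
    using eventually_ge_at_top[of 2]
  proof eventually_elim
    case (elim N)
    show ?case
    proof (rule ccontr)
      assume "\<not> ?case"
      then have "ereal (real N / (real N - 1) / (\<Sum>p<k. c ^ Suc p)) < dispersion A"
        by simp
      then have "\<forall>\<^sub>F i in sequentially. ereal (real N / (real N - 1) / (\<Sum>p<k. c ^ Suc p))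
          < ereal (max_gap A i / enumerate A i)"
        unfolding dispersion_eq_liminf_max_gap by (rule less_LiminfD)
      then obtain m where "\<And>i. m \<le> i \<Longrightarrow> real N / (real N - 1) / (\<Sum>p<k. c ^ Suc p)
          < max_gap A i / enumerate A i"
        by (auto simp: eventually_sequentially)
      then show False
        using frequently_small_max_gap[OF elim, of m] by fastforce
    qed
  qed
qed simp

lemma dispersion_eq: "dispersion A = ereal (1 / (\<Sum>p<k. c ^ Suc p))"
  using dispersion_ge dispersion_le by (rule antisym[rotated])

subsection \<open>The counting function\<close>

lemma card_block:
  assumes "j \<in> {1..k}"
  shows "card (block n j) = M n + 1"
proof -
  have "inj_on (\<lambda>i. q n j * (T n + i * s n)) {..M n}"
    using q_ge_1[OF assms, of n] s_pos[of n] by (auto simp: inj_on_def)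
  then show ?thesis
    by (simp add: block_def card_image)
qed

lemma finite_counted: "finite {a \<in> A. real a \<le> t}"
proof (rule finite_subset)
  show "{a \<in> A. real a \<le> t} \<subseteq> {..nat \<lfloor>t\<rfloor>}"
    by (auto simp: le_nat_floor)
qed simp

lemma counting_lower:
  fixes t :: real
  assumes "start \<le> n" "T (Suc n) \<le> t"
  shows "2 ^ e n / real (n + 1) \<le> counting A t"
proof -
  have "block n 1 \<subseteq> {a \<in> A. real a \<le> t}"
  proof
    fix a
    assume a: "a \<in> block n 1"
    have "1 \<in> {1..k}"
      using k_ge_1 by simp
    then have "a \<in> A"
      using a assms(1) unfolding A_iff by blast
    have "a \<le> real (n + 1) * (c + 2) * T n"
      using a \<open>1 \<in> {1..k}\<close> by (rule block_cluster_bounds(2))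
    also have "\<dots> \<le> 2 ^ (2 * n + 1) * real (T n)"
    proof (rule mult_right_mono)
      have "1 * (real (n + 1) * (c + 2)) \<le> 2 * (4 * (c + 2)) ^ k * (real (n + 1) * (c + 2))"
        using reach_ge_1 c_ge_1 by (intro mult_right_mono) auto
      then show "real (n + 1) * (c + 2) \<le> 2 ^ (2 * n + 1)"
        using separation[OF assms(1)] by linarith
    qed simp
    also have "\<dots> = T (Suc n)"
      by (simp add: T_Suc)
    finally show "a \<in> {a \<in> A. real a \<le> t}"
      using assms(2) \<open>a \<in> A\<close> by simp
  qed
  then have "card (block n 1) \<le> counting A t"
    unfolding counting_def by (intro card_mono finite_counted)
  then have "M n + 1 \<le> counting A t"
    using card_block[of 1 n] k_ge_1 by simp
  have "0 \<le> (c - 1) * 2 ^ e n"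
    using c_ge_1 by simp
  then have "2 ^ e n / real (n + 1) \<le> (c - 1 + 1 / real (n + 1)) * 2 ^ e n"
    unfolding distrib_right by simp
  also have "\<dots> \<le> M n"
    by (rule M_lower)
  also have "\<dots> \<le> counting A t"
    using \<open>M n + 1 \<le> counting A t\<close> by simp
  finally show ?thesis .
qed

lemma counting_upper:
  fixes t :: real
  assumes "t < T (Suc n)"
  shows "counting A t \<le> real (n + 1) * (real k * ((c + 2) * 2 ^ e n))"
proof -
  have "{a \<in> A. real a \<le> t} \<subseteq> (\<Union>m\<in>{..n}. \<Union>j\<in>{1..k}. block m j)"
  proof
    fix a
    assume a: "a \<in> {a \<in> A. real a \<le> t}"
    then obtain m j where m: "j \<in> {1..k}" "a \<in> block m j"
      by (auto simp: A_iff)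
    have "T m < T (Suc n)"
      using block_cluster_bounds(1)[OF m(2,1)] a assms by simp
    then have "m \<le> n"
      using T_mono[of "Suc n" m] by linarith
    then show "a \<in> (\<Union>m\<in>{..n}. \<Union>j\<in>{1..k}. block m j)"
      using m by blast
  qed
  then have "counting A t \<le> card (\<Union>m\<in>{..n}. \<Union>j\<in>{1..k}. block m j)"
    unfolding counting_def by (intro card_mono) (auto simp: block_def)
  also have "\<dots> \<le> (\<Sum>m\<le>n. card (\<Union>j\<in>{1..k}. block m j))"
    by (intro card_UN_le) simp
  also have "\<dots> \<le> (\<Sum>m\<le>n. \<Sum>j\<in>{1..k}. card (block m j))"
    by (intro sum_mono card_UN_le) simp
  also have "\<dots> = (\<Sum>m\<le>n. \<Sum>j\<in>{1..k}. M m + 1)"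
    by (intro sum.cong refl card_block)
  finally have "counting A t \<le> (\<Sum>m\<le>n. \<Sum>j\<in>{1..k}. M m + 1)" .
  then have "real (counting A t) \<le> real (\<Sum>m\<le>n. \<Sum>j\<in>{1..k}. M m + 1)"
    by (rule of_nat_mono)
  also have "\<dots> = (\<Sum>m\<le>n. \<Sum>j\<in>{1..k}. real (M m) + 1)"
    by (simp only: of_nat_sum of_nat_add of_nat_1)
  also have "\<dots> \<le> (\<Sum>m\<le>n. \<Sum>j\<in>{1..k}. (c + 2) * 2 ^ e n)"
  proof (intro sum_mono)
    fix m j
    assume "m \<in> {..n}"
    then have "(2::real) ^ e m \<le> 2 ^ e n"
      using e_mono by simp
    have "1 / real (m + 1) \<le> 1"
      by simp
    then have "(c - 1 + 1 / real (m + 1)) * 2 ^ e m \<le> c * 2 ^ e m"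
      by (intro mult_right_mono) auto
    moreover have "1 \<le> (2::real) ^ e m"
      by simp
    ultimately have "real (M m) + 1 \<le> (c + 2) * 2 ^ e m"
      using M_upper[of m] unfolding distrib_right by linarith
    also have "\<dots> \<le> (c + 2) * 2 ^ e n"
      using \<open>2 ^ e m \<le> 2 ^ e n\<close> c_ge_1 by (intro mult_left_mono) auto
    finally show "real (M m) + 1 \<le> (c + 2) * 2 ^ e n" .
  qed
  also have "\<dots> = real (n + 1) * (real k * ((c + 2) * 2 ^ e n))"
    by simp
  finally show ?thesis .
qed

text \<open>
  Let \<open>n\<close> be the integer part of \<open>u\<close>, so that \<open>T n \<le> t < T (n + 1)\<close>. The first block of cluster \<open>n - 1\<close>
  is counted completely, and nothing beyond cluster \<open>n\<close> is counted. Writing the bounds in terms of \<open>u\<close> reduces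
  the limit to one over real functions of a single variable.
\<close>

lemma ln_counting_bounds:
  fixes t :: real
  defines "u \<equiv> sqrt (log 2 t)"
  assumes t: "T (start + 3) \<le> t"
  shows "(l * (u - 2)\<^sup>2 - 1) * ln 2 - ln (u + 1) \<le> ln (counting A t)"
    and "ln (counting A t) \<le> ln (u + 1) + ln (real k * (c + 2)) + (u + l * u\<^sup>2) * ln 2"
    and "ln t = u\<^sup>2 * ln 2" and "0 < u"
proof -
  have T_powr: "real (T n) = 2 powr (real n)\<^sup>2" for n
    by (simp add: T_def powr_realpow[symmetric])
  have "0 < t"
    using t T_pos[of "start + 3"] by linarith
  have log_ge: "(real (start + 3))\<^sup>2 \<le> log 2 t"
    using t \<open>0 < t\<close> unfolding T_powr by (simp add: le_log_iff del: of_nat_add)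
  then have u_ge: "real (start + 3) \<le> u"
    unfolding u_def by (intro real_le_rsqrt)
  then show "0 < u" by simp
  have u_sq: "u\<^sup>2 = log 2 t"
    unfolding u_def using log_ge by (smt (verit) real_sqrt_pow2 zero_le_power2)
  then show "ln t = u\<^sup>2 * ln 2"
    by (simp add: log_def)
  have t_eq: "t = 2 powr u\<^sup>2"
    using \<open>0 < t\<close> by (simp add: u_sq)
  define n where "n = nat \<lfloor>u\<rfloor>"
  have n: "real n \<le> u" "u < real n + 1" "start + 3 \<le> n"
    using u_ge unfolding n_def by linarith+
  have "T n \<le> t"
    unfolding T_powr t_eq using n by (simp add: power_mono)
  define p where "p = n - 1"
  have p: "n = Suc p" "start \<le> p"
    using n(3) unfolding p_def by linarith+
  have "real (Suc n) ^ 2 > u\<^sup>2"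
    using n \<open>0 < u\<close> by (intro power_strict_mono) auto
  then have "t < T (Suc n)"
    unfolding T_powr t_eq by simp
  have low: "2 ^ e p / real (p + 1) \<le> counting A t"
    using \<open>T n \<le> t\<close> p(2) unfolding p(1) by (intro counting_lower)
  have "0 < 2 ^ e p / real (p + 1)"
    by simp
  then have pos: "0 < real (counting A t)"
    using low by linarith
  have "(l * (u - 2)\<^sup>2 - 1) * ln 2 - ln (u + 1) \<le> e p * ln 2 - ln (real (p + 1))"
  proof (intro diff_mono mult_right_mono)
    have "l * (u - 2)\<^sup>2 \<le> l * (real p)\<^sup>2"
      using n p l_ge_0 u_ge by (intro mult_left_mono power_mono) auto
    then show "l * (u - 2)\<^sup>2 - 1 \<le> real (e p)"
      using e_lower[of p] by linarith
    show "ln (real (p + 1)) \<le> ln (u + 1)"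
      using n p by simp
  qed simp
  also have "\<dots> = ln (2 ^ e p / real (p + 1))"
    by (simp add: ln_div ln_realpow)
  also have "\<dots> \<le> ln (counting A t)"
    using ln_le_cancel_iff[OF \<open>0 < 2 ^ e p / real (p + 1)\<close> pos] low by (rule iffD2)
  finally show "(l * (u - 2)\<^sup>2 - 1) * ln 2 - ln (u + 1) \<le> ln (counting A t)" .
  have kc: "0 < real k * (c + 2)"
    using k_ge_1 c_ge_1 by simp
  have "ln (counting A t) \<le> ln (real (n + 1) * (real k * (c + 2)) * 2 ^ e n)"
    using counting_upper[OF \<open>t < T (Suc n)\<close>] pos by (simp add: mult.assoc)
  also have "\<dots> = ln (real (n + 1)) + ln (real k * (c + 2)) + e n * ln 2"
  proof -
    have "ln (real (n + 1) * (real k * (c + 2)) * 2 ^ e n)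
        = ln (real (n + 1) * (real k * (c + 2))) + ln (2 ^ e n)"
      using kc by (intro ln_mult_pos) simp_all
    moreover have "ln (real (n + 1) * (real k * (c + 2))) = ln (real (n + 1)) + ln (real k * (c + 2))"
      using kc by (intro ln_mult_pos) simp_all
    ultimately show ?thesis
      by (simp only: ln_realpow zero_less_numeral)
  qed
  also have "\<dots> \<le> ln (u + 1) + ln (real k * (c + 2)) + (u + l * u\<^sup>2) * ln 2"
  proof (intro add_mono mult_right_mono)
    have "l * (real n)\<^sup>2 \<le> l * u\<^sup>2"
      using n l_ge_0 by (intro mult_left_mono power_mono) auto
    then show "real (e n) \<le> u + l * u\<^sup>2"
      using e_upper[of n] n by linarith
    show "ln (real (n + 1)) \<le> ln (u + 1)"
      using n by simp
  qed simp_all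
  finally show "ln (counting A t) \<le> ln (u + 1) + ln (real k * (c + 2)) + (u + l * u\<^sup>2) * ln 2" .
qed

lemma counting_exponent: "((\<lambda>t. ln (real (counting A t)) / ln t) \<longlongrightarrow> l) at_top"
proof (rule tendsto_sandwich)
  define u :: "real \<Rightarrow> real" where "u t = sqrt (log 2 t)" for t
  have u: "filterlim u at_top at_top"
    unfolding u_def by real_asymp
  define C where "C = ln (real k * (c + 2))"
  have "((\<lambda>x. ((l * (x - 2)\<^sup>2 - 1) * ln 2 - ln (x + 1)) / (x\<^sup>2 * ln 2)) \<longlongrightarrow> l) at_top"
    by real_asymp
  then show "((\<lambda>t. ((l * (u t - 2)\<^sup>2 - 1) * ln 2 - ln (u t + 1)) / ((u t)\<^sup>2 * ln 2)) \<longlongrightarrow> l) at_top"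
    using u by (rule filterlim_compose)
  have "((\<lambda>x. (ln (x + 1) + C + (x + l * x\<^sup>2) * ln 2) / (x\<^sup>2 * ln 2)) \<longlongrightarrow> l) at_top"
    by real_asymp
  then show "((\<lambda>t. (ln (u t + 1) + C + (u t + l * (u t)\<^sup>2) * ln 2) / ((u t)\<^sup>2 * ln 2)) \<longlongrightarrow> l) at_top"
    using u by (rule filterlim_compose)
  show "\<forall>\<^sub>F t in at_top. ((l * (u t - 2)\<^sup>2 - 1) * ln 2 - ln (u t + 1)) / ((u t)\<^sup>2 * ln 2)
      \<le> ln (counting A t) / ln t"
    using eventually_ge_at_top[of "real (T (start + 3))"]
  proof eventually_elim
    case (elim t)
    show ?case
      using ln_counting_bounds[OF elim] unfolding u_def by (simp add: divide_right_mono)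
  qed
  show "\<forall>\<^sub>F t in at_top. ln (counting A t) / ln t
      \<le> (ln (u t + 1) + C + (u t + l * (u t)\<^sup>2) * ln 2) / ((u t)\<^sup>2 * ln 2)"
    using eventually_ge_at_top[of "real (T (start + 3))"]
  proof eventually_elim
    case (elim t)
    show ?case
      using ln_counting_bounds[OF elim] unfolding u_def C_def by (simp add: divide_right_mono)
  qed
qed

end

section \<open>Choice of the parameters\<close>

lemma exists_width:
  assumes "1 \<le> k" "0 < d" "d \<le> 1 / real k"
  obtains c :: real where "1 \<le> c" "(\<Sum>p<k. c ^ Suc p) = 1 / d"
proof -
  have kd: "real k \<le> 1 / d"
    using assms by (simp add: field_simps)
  have "\<exists>c\<ge>1. c \<le> 1 / d \<and> (\<Sum>p<k. c ^ Suc p) = 1 / d"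
  proof (rule IVT')
    show "(\<Sum>p<k. 1 ^ Suc p) \<le> 1 / d"
      using kd by simp
    have "(1 / d) ^ Suc 0 \<le> (\<Sum>p<k. (1 / d) ^ Suc p)"
      using assms by (intro member_le_sum[where i = 0 and f = "\<lambda>p. (1 / d) ^ Suc p"]) auto
    then show "1 / d \<le> (\<Sum>p<k. (1 / d) ^ Suc p)"
      by simp
    show "1 \<le> 1 / d"
      using kd assms(1) by linarith
    show "continuous_on {1..1 / d} (\<lambda>c. \<Sum>p<k. c ^ Suc p)"
      by (intro continuous_intros)
  qed
  then show ?thesis using that by blast
qed

theorem theorem6:
  fixes k :: nat and d l :: real
  assumes "k \<ge> 1" and "0 < d" and "d \<le> 1 / real k" and "0 \<le> l" and "l \<le> 1"
  shows "\<exists>A :: nat set. A \<subseteq> {1..} \<and> infinite A \<and>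
           (k \<ge> 2 \<longrightarrow> dense_in_pos_orthant (k - 1) (ratio_set k A)) \<and>
           \<not> dense_in_pos_orthant k (ratio_set (k + 1) A) \<and>
           dispersion A = ereal d \<and>
           ((\<lambda>t. ln (real (counting A t)) / ln t) \<longlongrightarrow> l) at_top"
proof -
  obtain c :: real where c: "1 \<le> c" "(\<Sum>p<k. c ^ Suc p) = 1 / d"
    using exists_width assms by metis
  obtain q :: "nat \<Rightarrow> nat \<Rightarrow> nat" where q: "\<forall>n. \<forall>j\<in>{1..k}. 1 \<le> q n j \<and> q n j \<le> n + 1"
    "\<forall>t. (\<forall>j\<in>{1..k}. 1 \<le> t j) \<longrightarrow> (\<forall>m. \<exists>n\<ge>m. \<forall>j\<in>{1..k}. q n j = t j)"
    using exists_recurrent_tuples[of k] by blast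
  have "\<forall>\<^sub>F n in sequentially. 2 * (4 * (c + 2)) ^ k * (real (n + 1) * (c + 2)) < 2 ^ (2 * n + 1)"
    by real_asymp
  then obtain start where start:
    "\<And>n. start \<le> n \<Longrightarrow> 2 * (4 * (c + 2)) ^ k * (real (n + 1) * (c + 2)) < 2 ^ (2 * n + 1)"
    by (auto simp: eventually_sequentially)
  interpret clusters k start c l q
  proof
    show "\<exists>n\<ge>m. \<forall>j\<in>{1..k}. q n j = t j" if "\<And>j. j \<in> {1..k} \<Longrightarrow> 1 \<le> t j" for t m
      using q(2) that by blast
  qed (use assms c q(1) start in auto)
  show ?thesis
    using A_ge_1 infinite_A dense_ratio_set not_dense_ratio_set dispersion_eq counting_exponent c(2)
    by (intro exI[of _ A]) simp
qed

end
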